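(* Consider the following plane curves in $\mathbb{P}^2_{\mathbb{C}}$: $$C_{1} = V\big((x^{4}+y^{4}+z^{4})(x^{4}+y^{4})(y^{4}+z^{4})\big),$$ $$C_{2} = V\big((x^{4}+y^{4}+z^{4})(x^{4}+y^{4})(x^{4}+z^{4})\big),$$ $$C_{3} = V\big((x^{4}+y^{4}+z^{4})(y^{4}+z^{4})(x^{4}+z^{4})\big).$$ Then the curves $C_{1}, C_{2}, C_{3}$ are nearly-free with exponents $(d_{1},d_{2},d_{3}) = (5,7,7)$.
   Context: Let $S=\mathbb{C}[x,y,z]$. For a reduced curve $C: f=0$ of degree $d$ in $\mathbb{P}^2_{\mathbb{C}}$, let $J_f$ be the ideal generated by the partial derivatives of $f$ and $M(f)=S/J_f$ the Milnor algebra. $C$ is an $m$-syzygy curve if $M(f)$ has minimal graded free resolution $$0 \rightarrow \bigoplus_{i=1}^{m-2}S(-e_{i}) \rightarrow \bigoplus_{i=1}^{m}S(1-d - d_{i}) \rightarrow S^{3}(1-d)\rightarrow S \rightarrow M(f) \rightarrow 0$$ with $e_{1} \leq \dots \leq e_{m-2}$ and $1\leq d_{1} \leq \dots \leq d_{m}$; the $d_i$ are called the exponents. $C$ is nearly-free if $m=3$, $d_1+d_2=d$, $d_2=d_3$ and $e_1=d+d_2$. *)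

theory Defs
  imports
    "HOL-Computational_Algebra.Computational_Algebra"
    "Jordan_Normal_Form.Matrix_Kernel"
begin

text \<open>
  The ring \<open>S = \<complex>[x,y,z]\<close> is the iterated polynomial ring \<open>\<complex>[x][y][z]\<close>, so \<open>z\<close> is the variable
  of the outermost layer and \<open>x\<close> that of the innermost one.
\<close>

type_synonym cpoly3 = "complex poly poly poly"

definition var_x :: cpoly3 where "var_x = [:[:[:0, 1:]:]:]"
definition var_y :: cpoly3 where "var_y = [:[:0, 1:]:]"
definition var_z :: cpoly3 where "var_z = [:0, 1:]"

definition partial_x :: "cpoly3 \<Rightarrow> cpoly3" where "partial_x f = map_poly (map_poly pderiv) f"
definition partial_y :: "cpoly3 \<Rightarrow> cpoly3" where "partial_y f = map_poly pderiv f"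
definition partial_z :: "cpoly3 \<Rightarrow> cpoly3" where "partial_z f = pderiv f"

text \<open>
  \<open>homogeneous n f\<close>: \<open>f\<close> lies in the graded piece \<open>S\<^sub>n\<close>. The zero polynomial lies in every piece,
  and \<open>S\<^sub>n = 0\<close> for \<open>n < 0\<close>.
\<close>

definition homogeneous :: "int \<Rightarrow> cpoly3 \<Rightarrow> bool" where
  "homogeneous n f \<longleftrightarrow>
     (\<forall>i j k. coeff (coeff (coeff f k) j) i \<noteq> 0 \<longrightarrow> int (i + j + k) = n)"

definition jacobian_ideal :: "cpoly3 \<Rightarrow> cpoly3 set" where
  "jacobian_ideal f = {a * partial_x f + b * partial_y f + c * partial_z f | a b c. True}"

text \<open>
  A list \<open>as\<close> of twists stands for the graded free module \<open>\<Oplus>\<^sub>i S(as ! i)\<close>, whose elements are the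
  vectors in \<open>carrier_vec (length as)\<close>. The generator of \<open>S(b)\<close> has degree \<open>-b\<close>, and
  \<open>S(a)\<close> in degree \<open>-b\<close> is \<open>S\<^sub>a\<^sub>-\<^sub>b\<close>; so a degree-preserving map
  \<open>\<Oplus>\<^sub>j S(bs ! j) \<rightarrow> \<Oplus>\<^sub>i S(as ! i)\<close> is a matrix whose entry \<open>(i, j)\<close> is homogeneous of degree
  \<open>as ! i - bs ! j\<close>.
\<close>

definition graded_map :: "int list \<Rightarrow> int list \<Rightarrow> cpoly3 mat \<Rightarrow> bool" where
  "graded_map bs as A \<longleftrightarrow>
     A \<in> carrier_mat (length as) (length bs) \<and>
     (\<forall>i < length as. \<forall>j < length bs. homogeneous (as ! i - bs ! j) (A $$ (i, j)))"

text \<open>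
  Minimality of a graded map: its image lies in \<open>(x,y,z)\<close> times the target, i.e. every matrix entry
  has zero constant term.
\<close>

definition minimal_map :: "cpoly3 mat \<Rightarrow> bool" where
  "minimal_map A \<longleftrightarrow>
     (\<forall>i < dim_row A. \<forall>j < dim_col A. coeff (coeff (coeff (A $$ (i, j)) 0) 0) 0 = 0)"

definition mat_image :: "cpoly3 mat \<Rightarrow> cpoly3 vec set" where
  "mat_image A = {A *\<^sub>v v | v. v \<in> carrier_vec (dim_col A)}"

text \<open>
  The minimal graded free resolution
  \<open>0 \<rightarrow> \<Oplus>\<^sub>i S(-e\<^sub>i) \<rightarrow> \<Oplus>\<^sub>i S(1-d-d\<^sub>i) \<rightarrow> S\<^sup>3(1-d) \<rightarrow> S \<rightarrow> M(f) \<rightarrow> 0\<close>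
  of the Milnor algebra \<open>M(f) = S/J\<^sub>f\<close>, with \<open>ds = [d\<^sub>1, \<dots>, d\<^sub>m]\<close>, \<open>es = [e\<^sub>1, \<dots>, e\<^sub>m\<^sub>-\<^sub>2]\<close>.
  The last map is the projection \<open>S \<rightarrow> S/J\<^sub>f\<close>, which is onto with kernel \<open>J\<^sub>f\<close>; hence exactness at
  \<open>S\<close> says that the image of the matrix \<open>A\<^sub>1\<close> is \<open>J\<^sub>f\<close>.
\<close>

definition milnor_resolution :: "nat \<Rightarrow> cpoly3 \<Rightarrow> nat list \<Rightarrow> nat list \<Rightarrow> bool" where
  "milnor_resolution d f ds es \<longleftrightarrow>
     (\<exists>A\<^sub>1 A\<^sub>2 A\<^sub>3.
        graded_map (replicate 3 (1 - int d)) [0] A\<^sub>1 \<and>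
        graded_map (map (\<lambda>di. 1 - int d - int di) ds) (replicate 3 (1 - int d)) A\<^sub>2 \<and>
        graded_map (map (\<lambda>e. - int e) es) (map (\<lambda>di. 1 - int d - int di) ds) A\<^sub>3 \<and>
        minimal_map A\<^sub>1 \<and> minimal_map A\<^sub>2 \<and> minimal_map A\<^sub>3 \<and>
        mat_image A\<^sub>1 = {v \<in> carrier_vec 1. v $ 0 \<in> jacobian_ideal f} \<and>
        mat_image A\<^sub>2 = mat_kernel A\<^sub>1 \<and>
        mat_image A\<^sub>3 = mat_kernel A\<^sub>2 \<and>
        mat_kernel A\<^sub>3 = {0\<^sub>v (length es)})"

text \<open>
  A plane curve \<open>C: f = 0\<close> is given by its defining form \<open>f\<close>.
\<close>

definition reduced_curve :: "nat \<Rightarrow> cpoly3 \<Rightarrow> bool" where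
  "reduced_curve d f \<longleftrightarrow> d \<ge> 1 \<and> homogeneous (int d) f \<and> squarefree f"

definition syzygy_curve :: "nat \<Rightarrow> nat \<Rightarrow> cpoly3 \<Rightarrow> nat list \<Rightarrow> nat list \<Rightarrow> bool" where
  "syzygy_curve m d f ds es \<longleftrightarrow>
     reduced_curve d f \<and>
     length ds = m \<and> length es + 2 = m \<and>
     sorted ds \<and> (\<forall>di \<in> set ds. 1 \<le> di) \<and> sorted es \<and>
     milnor_resolution d f ds es"

definition has_exponents :: "cpoly3 \<Rightarrow> nat list \<Rightarrow> bool" where
  "has_exponents f ds \<longleftrightarrow> (\<exists>m d es. syzygy_curve m d f ds es)"

definition nearly_free :: "cpoly3 \<Rightarrow> bool" where
  "nearly_free f \<longleftrightarrow>
     (\<exists>d d\<^sub>1 d\<^sub>2 d\<^sub>3 e\<^sub>1. syzygy_curve 3 d f [d\<^sub>1, d\<^sub>2, d\<^sub>3] [e\<^sub>1] \<and>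
        d\<^sub>1 + d\<^sub>2 = d \<and> d\<^sub>2 = d\<^sub>3 \<and> e\<^sub>1 = d + d\<^sub>2)"

definition curve_C1 :: cpoly3 where
  "curve_C1 = (var_x ^ 4 + var_y ^ 4 + var_z ^ 4) * (var_x ^ 4 + var_y ^ 4) * (var_y ^ 4 + var_z ^ 4)"

definition curve_C2 :: cpoly3 where
  "curve_C2 = (var_x ^ 4 + var_y ^ 4 + var_z ^ 4) * (var_x ^ 4 + var_y ^ 4) * (var_x ^ 4 + var_z ^ 4)"

definition curve_C3 :: cpoly3 where
  "curve_C3 = (var_x ^ 4 + var_y ^ 4 + var_z ^ 4) * (var_y ^ 4 + var_z ^ 4) * (var_x ^ 4 + var_z ^ 4)"

end

theory Submission
  imports Defs "HOL-Computational_Algebra.Field_as_Ring"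
begin

text \<open>
  Up to a permutation of the variables the curve is \<open>(a + b + c)(a + b)(b + c) = 0\<close> with
  \<open>a = X\<^sup>4\<close>, \<open>b = Y\<^sup>4\<close>, \<open>c = Z\<^sup>4\<close>. Its gradient is \<open>4 h\<close>, and \<open>h\<close> has three
  explicit syzygies \<open>r1\<close>, \<open>r2\<close>, \<open>r3\<close> of degrees 5, 7, 7 with
  \<open>r2 \<times> r3 = 3 Y\<^sup>3 h\<close>, \<open>r3 \<times> r1 = 3 Z h\<close>, \<open>r1 \<times> r2 = -3 X h\<close> and
  \<open>X r3 = Y\<^sup>3 r1 + Z r2\<close>. Since the entries of \<open>h\<close> are coprime, the cross product of any two
  syzygies is a multiple of \<open>h\<close>. For a syzygy \<open>s\<close> this gives \<open>s \<times> ri = li h\<close>; the relation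
  between the \<open>ri\<close> becomes a relation between the \<open>li\<close> with coefficients in the regular sequence
  \<open>Y\<^sup>3, Z, X\<close>, and its Koszul solution is the vector of coefficients of \<open>s\<close> in terms of
  the \<open>ri\<close>.
\<close>

section \<open>Derivations\<close>

text \<open>Additivity and the Leibniz rule suffice to compute the gradients below from the values
  on the variables. One notion for all three partial derivatives lets them be permuted together with
  the variables.\<close>

definition derivation :: "('a::comm_ring_1 \<Rightarrow> 'a) \<Rightarrow> bool" where
  "derivation D \<longleftrightarrow> (\<forall>p q. D (p + q) = D p + D q) \<and> (\<forall>p q. D (p * q) = D p * q + p * D q)"

lemma derivation_add: "derivation D \<Longrightarrow> D (p + q) = D p + D q"
  and derivation_mult: "derivation D \<Longrightarrow> D (p * q) = D p * q + p * D q"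
  by (simp_all add: derivation_def)

lemma derivation_0: "derivation D \<Longrightarrow> D 0 = 0"
  using derivation_add[of D 0 0] by simp

lemma derivation_sum: "derivation D \<Longrightarrow> D (sum f A) = (\<Sum>i\<in>A. D (f i))"
  by (induction A rule: infinite_finite_induct) (simp_all add: derivation_0 derivation_add)

lemma derivation_power: "derivation D \<Longrightarrow> D (p ^ Suc n) = of_nat (Suc n) * p ^ n * D p"
  by (induction n) (simp_all add: derivation_mult algebra_simps)

lemma derivation_pderiv: "derivation pderiv"
  by (simp add: derivation_def pderiv_add pderiv_mult algebra_simps)

text \<open>A coefficient of a product is a convolution sum, and the Leibniz rule holds summand by
  summand. Each use carries \<open>pderiv\<close> out by one layer of the iterated polynomial
  ring.\<close>

lemma derivation_map_poly:
  assumes "derivation D"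
  shows "derivation (map_poly D)"
  unfolding derivation_def
  using derivation_0[OF assms]
  by (auto intro!: poly_eqI simp: coeff_map_poly coeff_mult derivation_add[OF assms]
      derivation_sum[OF assms] derivation_mult[OF assms] sum.distrib)

lemma derivation_partials:
  "derivation partial_x" "derivation partial_y" "derivation partial_z"
  unfolding partial_x_def[abs_def] partial_y_def[abs_def] partial_z_def[abs_def]
  by (intro derivation_map_poly derivation_pderiv)+

lemma partials_of_vars:
  "partial_x var_x = 1" "partial_x var_y = 0" "partial_x var_z = 0"
  "partial_y var_x = 0" "partial_y var_y = 1" "partial_y var_z = 0"
  "partial_z var_x = 0" "partial_z var_y = 0" "partial_z var_z = 1"
  by (simp_all add: partial_x_def partial_y_def partial_z_def var_x_def var_y_def var_z_def
      map_poly_pCons pderiv_pCons one_pCons)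

section \<open>Homogeneous polynomials\<close>

lemma homogeneous_add: "homogeneous n f \<Longrightarrow> homogeneous n g \<Longrightarrow> homogeneous n (f + g)"
  unfolding homogeneous_def by (metis add.right_neutral coeff_add)

lemma homogeneous_uminus: "homogeneous n f \<Longrightarrow> homogeneous n (- f)"
  unfolding homogeneous_def by simp

lemma homogeneous_diff: "homogeneous n f \<Longrightarrow> homogeneous n g \<Longrightarrow> homogeneous n (f - g)"
  using homogeneous_add[of n f "- g"] homogeneous_uminus by simp

text \<open>A nonzero coefficient of the product has a nonzero summand in its convolution; the
  exponents of the two factors of that summand add up to \<open>m\<close> and
  \<open>n\<close>.\<close>

lemma homogeneous_mult:
  assumes "homogeneous m f" "homogeneous n g"
  shows "homogeneous (m + n) (f * g)"
  unfolding homogeneous_def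
proof (intro allI impI)
  fix i j k
  assume "coeff (coeff (coeff (f * g) k) j) i \<noteq> 0"
  hence "(\<Sum>r\<le>k. \<Sum>s\<le>j. \<Sum>t\<le>i. coeff (coeff (coeff f r) s) t *
      coeff (coeff (coeff g (k - r)) (j - s)) (i - t)) \<noteq> 0"
    by (simp add: coeff_mult coeff_sum)
  then obtain r s t where "r \<le> k" "s \<le> j" "t \<le> i"
    and "coeff (coeff (coeff f r) s) t * coeff (coeff (coeff g (k - r)) (j - s)) (i - t) \<noteq> 0"
    by (metis (no_types, lifting) atMost_iff sum.not_neutral_contains_not_neutral)
  with assms[unfolded homogeneous_def] have "int (t + s + r) = m"
    "int ((i - t) + (j - s) + (k - r)) = n"
    by (metis mult_zero_left, metis mult_zero_right)
  thus "int (i + j + k) = m + n" using \<open>r \<le> k\<close> \<open>s \<le> j\<close> \<open>t \<le> i\<close> by linarith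
qed

text \<open>The separate variable for the degree lets the rule apply to goals whose degree is a
  numeral.\<close>

lemma homogeneous_mult_eq: "homogeneous m f \<Longrightarrow> homogeneous n g \<Longrightarrow> k = m + n \<Longrightarrow>
    homogeneous k (f * g)"
  by (simp add: homogeneous_mult)

lemma homogeneous_1: "homogeneous 0 1"
  by (auto simp: homogeneous_def one_pCons coeff_pCons split: nat.splits)

lemma homogeneous_power: "homogeneous m f \<Longrightarrow> homogeneous (int n * m) (f ^ n)"
  by (induction n) (auto simp: homogeneous_1 algebra_simps dest: homogeneous_mult)

lemma homogeneous_numeral_mult: "homogeneous n f \<Longrightarrow> homogeneous n (numeral k * f)"
  unfolding homogeneous_def by (simp add: numeral_poly)

lemma homogeneous_vars: "homogeneous 1 var_x" "homogeneous 1 var_y" "homogeneous 1 var_z"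
  by (auto simp: homogeneous_def var_x_def var_y_def var_z_def one_pCons coeff_pCons split: nat.splits)

section \<open>Coprimality of linear forms in the fourth powers of the variables\<close>

text \<open>A divisor of a nonzero constant is a constant; as such it divides every coefficient of
  \<open>m\<close>, among them a unit.\<close>

lemma unit_if_dvd_const_poly:
  fixes p :: "'a::idom poly"
  assumes "p dvd [:h:]" "h \<noteq> 0" "p dvd m" "coeff m k dvd 1"
  shows "p dvd 1"
proof -
  have "degree p \<le> degree [:h:]" using assms(1,2) by (intro dvd_imp_degree_le) auto
  then obtain q where q: "p = [:q:]" by (auto elim: degree_eq_zeroE)
  hence "q dvd coeff m k" using assms(3) by (simp add: const_poly_dvd_iff)
  hence "q dvd 1" using assms(4) dvd_trans by blast
  thus ?thesis by (simp add: q is_unit_const_poly_iff)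
qed

text \<open>This is \<alpha> x^4 + \<beta> y^4 + \<gamma> z^4, written layer by layer so that its
  coefficients with respect to each variable can be read off.\<close>

definition quartic_form :: "complex \<Rightarrow> complex \<Rightarrow> complex \<Rightarrow> cpoly3" where
  "quartic_form \<alpha> \<beta> \<gamma> = [:[:monom \<alpha> 4:] + monom [:\<beta>:] 4:] + monom [:[:\<gamma>:]:] 4"

lemma quartic_form_elim_z:
  "[:[:[:\<gamma>':]:]:] * quartic_form \<alpha> \<beta> \<gamma> - [:[:[:\<gamma>:]:]:] * quartic_form \<alpha>' \<beta>' \<gamma>' =
   [:[:monom (\<gamma>'*\<alpha> - \<gamma>*\<alpha>') 4:] + monom [:\<gamma>'*\<beta> - \<gamma>*\<beta>':] 4:]"
  by (auto intro!: poly_eqI simp: quartic_form_def coeff_pCons mult.commute split: nat.splits)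

lemma vars_power4:
  "var_x ^ 4 = quartic_form 1 0 0" "var_y ^ 4 = quartic_form 0 1 0" "var_z ^ 4 = quartic_form 0 0 1"
  by (simp_all add: quartic_form_def var_x_def var_y_def var_z_def poly_const_pow monom_altdef
      flip: one_pCons)

lemma quartic_form_algebra:
  "quartic_form \<alpha> \<beta> \<gamma> + quartic_form \<alpha>' \<beta>' \<gamma>' = quartic_form (\<alpha> + \<alpha>') (\<beta> + \<beta>') (\<gamma> + \<gamma>')"
  "numeral n * quartic_form \<alpha> \<beta> \<gamma> = quartic_form (numeral n * \<alpha>) (numeral n * \<beta>) (numeral n * \<gamma>)"
  by (auto intro!: poly_eqI simp: quartic_form_def numeral_poly coeff_pCons split: nat.splits)

lemma binary_form_eq_0_iff:
  fixes \<alpha> \<beta> :: complex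
  shows "[:monom \<alpha> 4:] + monom [:\<beta>:] 4 = 0 \<longleftrightarrow> \<alpha> = 0 \<and> \<beta> = 0"
proof
  assume *: "[:monom \<alpha> 4:] + monom [:\<beta>:] 4 = 0"
  show "\<alpha> = 0 \<and> \<beta> = 0"
    using arg_cong[OF *, of "\<lambda>p. coeff p 0"] arg_cong[OF *, of "\<lambda>p. coeff p 4"]
    by (simp add: coeff_pCons split: nat.splits)
qed simp

text \<open>The hypothesis says that the two coefficient vectors are linearly independent.
  Eliminating z^4 leaves a nonzero form in x and y, so a common divisor is free of z and divides the
  coefficient of z^4 in one of the forms, which is a unit. If z occurs in neither form, the argument
  is repeated one layer down with y.\<close>

lemma coprime_quartic_forms:
  assumes "\<alpha>*\<beta>' \<noteq> \<alpha>'*\<beta> \<or> \<alpha>*\<gamma>' \<noteq> \<alpha>'*\<gamma> \<or> \<beta>*\<gamma>' \<noteq> \<beta>'*\<gamma>"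
  shows "coprime (quartic_form \<alpha> \<beta> \<gamma>) (quartic_form \<alpha>' \<beta>' \<gamma>')"
proof (rule coprimeI)
  fix p assume p: "p dvd quartic_form \<alpha> \<beta> \<gamma>" "p dvd quartic_form \<alpha>' \<beta>' \<gamma>'"
  have lead: "coeff (quartic_form s t u) 4 dvd 1" if "u \<noteq> 0" for s t u
    using that by (simp add: quartic_form_def coeff_pCons is_unit_const_poly_iff dvd_field_iff
        split: nat.splits)
  show "p dvd 1"
  proof (cases "\<gamma> = 0 \<and> \<gamma>' = 0")
    case False
    have "p dvd [:[:[:\<gamma>':]:]:] * quartic_form \<alpha> \<beta> \<gamma> - [:[:[:\<gamma>:]:]:] * quartic_form \<alpha>' \<beta>' \<gamma>'"
      by (intro dvd_diff dvd_mult p)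
    hence "p dvd [:[:monom (\<gamma>'*\<alpha> - \<gamma>*\<alpha>') 4:] + monom [:\<gamma>'*\<beta> - \<gamma>*\<beta>':] 4:]"
      by (simp only: quartic_form_elim_z)
    moreover have "[:monom (\<gamma>'*\<alpha> - \<gamma>*\<alpha>') 4:] + monom [:\<gamma>'*\<beta> - \<gamma>*\<beta>':] 4 \<noteq> 0"
      unfolding binary_form_eq_0_iff
    proof
      \<comment> \<open>If both coefficients vanished, so would every 2x2 minor: the remaining one
        is annihilated by \<gamma> and \<gamma>', which are not both zero.\<close>
      assume *: "\<gamma>'*\<alpha> - \<gamma>*\<alpha>' = 0 \<and> \<gamma>'*\<beta> - \<gamma>*\<beta>' = 0"
      hence e: "\<gamma>'*\<alpha> = \<gamma>*\<alpha>'" "\<gamma>'*\<beta> = \<gamma>*\<beta>'" by simp_all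
      have "\<gamma>*(\<alpha>*\<beta>' - \<alpha>'*\<beta>) = \<alpha>*(\<gamma>*\<beta>') - (\<gamma>*\<alpha>')*\<beta>" by (simp add: algebra_simps)
      hence "\<gamma>*(\<alpha>*\<beta>' - \<alpha>'*\<beta>) = 0" by (simp flip: e)
      moreover have "\<gamma>'*(\<alpha>*\<beta>' - \<alpha>'*\<beta>) = (\<gamma>'*\<alpha>)*\<beta>' - \<alpha>'*(\<gamma>'*\<beta>)" by (simp add: algebra_simps)
      hence "\<gamma>'*(\<alpha>*\<beta>' - \<alpha>'*\<beta>) = 0" by (simp add: e)
      ultimately have "\<alpha>*\<beta>' = \<alpha>'*\<beta>" using False by auto
      thus False using assms e by (auto simp: mult.commute)
    qed
    ultimately show ?thesis
      using False unit_if_dvd_const_poly[OF _ _ p(1) lead] unit_if_dvd_const_poly[OF _ _ p(2) lead]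
      by blast
  next
    case True
    define l where "l s t = [:monom s 4:] + monom [:t:] 4" for s t :: complex
    have p': "p dvd [:l \<alpha> \<beta>:]" "p dvd [:l \<alpha>' \<beta>':]"
      using p True by (simp_all add: quartic_form_def l_def)
    have m: "\<alpha>*\<beta>' - \<alpha>'*\<beta> \<noteq> 0" using assms True by auto
    hence "l \<alpha> \<beta> \<noteq> 0" unfolding l_def binary_form_eq_0_iff by auto
    hence "degree p \<le> degree [:l \<alpha> \<beta>:]" using p'(1) by (intro dvd_imp_degree_le) auto
    then obtain q where q: "p = [:q:]" by (auto elim: degree_eq_zeroE)
    hence ql: "q dvd l \<alpha> \<beta>" "q dvd l \<alpha>' \<beta>'" using p' by auto
    \<comment> \<open>Eliminating y^4 leaves a nonzero minor times x^4, a constant in y. Since the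
      minor is nonzero, \<beta> or \<beta>' is nonzero, and that form has a unit as its coefficient
      of y^4.\<close>
    have "[:monom (\<alpha>*\<beta>' - \<alpha>'*\<beta>) 4:] = [:[:\<beta>':]:] * l \<alpha> \<beta> - [:[:\<beta>:]:] * l \<alpha>' \<beta>'"
      by (simp add: l_def smult_monom smult_add_right diff_monom mult.commute)
    hence "q dvd [:monom (\<alpha>*\<beta>' - \<alpha>'*\<beta>) 4:]" using ql by (metis dvd_diff dvd_mult)
    moreover have "coeff (l s t) 4 dvd 1" if "t \<noteq> 0" for s t
      using that by (simp add: l_def coeff_pCons is_unit_const_poly_iff dvd_field_iff
          split: nat.splits)
    ultimately have "q dvd 1"
      using m unit_if_dvd_const_poly[of q "monom (\<alpha>*\<beta>' - \<alpha>'*\<beta>) 4" "l \<alpha> \<beta>" 4]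
        unit_if_dvd_const_poly[of q "monom (\<alpha>*\<beta>' - \<alpha>'*\<beta>) 4" "l \<alpha>' \<beta>'" 4] ql
      by (cases "\<beta> = 0") auto
    thus ?thesis by (simp add: q is_unit_const_poly_iff)
  qed
qed

section \<open>Square divisors and cross products of syzygies over general rings\<close>

lemma derivation_square_dvd:
  assumes "derivation D" "p\<^sup>2 dvd f"
  shows "p dvd D f"
proof -
  obtain k where "f = p * (p * k)" using assms(2) by (auto simp: dvd_def power2_eq_square mult.assoc)
  thus ?thesis using assms(1) by (simp add: derivation_mult)
qed

text \<open>Being coprime to \<open>h\<close>, \<open>f\<close> divides \<open>p\<close> because it
  divides \<open>p * h\<close>; the quotient is the common factor.\<close>

lemma parallel_to_coprime:
  fixes f g h p q r :: "'a::semiring_gcd"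
  assumes "coprime f h" "f \<noteq> 0" and "p * g = q * f" "p * h = r * f"
  shows "\<exists>l. p = l * f \<and> q = l * g \<and> r = l * h"
proof -
  have "f dvd p * h" using assms(4) by simp
  hence "f dvd p" using assms(1) by (simp add: coprime_dvd_mult_left_iff)
  then obtain l where l: "p = l * f" by (auto simp: dvd_def mult.commute)
  have "f * q = f * (l * g)" "f * r = f * (l * h)"
    using assms(3,4) unfolding l by (simp_all only: ac_simps)
  hence "q = l * g" "r = l * h" by (metis assms(2) mult_left_cancel)+
  thus ?thesis using l by blast
qed

text \<open>Two vectors orthogonal to \<open>(f, g, h)\<close> have a cross product parallel to it;
  the identities in the proof are, up to sign, components of the expansion of the double cross
  product.\<close>

lemma cross_product_parallel:
  fixes f g h p q r p' q' r' :: "'a::{semiring_gcd,idom}"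
  assumes "coprime f h" "f \<noteq> 0" and "p * f + q * g + r * h = 0" "p' * f + q' * g + r' * h = 0"
  shows "\<exists>l. q * r' - r * q' = l * f \<and> r * p' - p * r' = l * g \<and> p * q' - q * p' = l * h"
proof (rule parallel_to_coprime[OF assms(1,2)])
  have "(q * r' - r * q') * g - (r * p' - p * r') * f =
      r' * (p * f + q * g + r * h) - r * (p' * f + q' * g + r' * h)"
    by (simp add: algebra_simps)
  thus "(q * r' - r * q') * g = (r * p' - p * r') * f" by (simp add: assms(3,4))
  have "(q * r' - r * q') * h - (p * q' - q * p') * f =
      q * (p' * f + q' * g + r' * h) - q' * (p * f + q * g + r * h)"
    by (simp add: algebra_simps)
  thus "(q * r' - r * q') * h = (p * q' - q * p') * f" by (simp add: assms(3,4))
qed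

text \<open>Since 3 is invertible, Koszul coefficients can be written as multiples of 3, matching
  the factor 3 in the cross products of the syzygies.\<close>

lemma ex_third: "\<exists>\<alpha>'. \<alpha> = 3 * \<alpha>'" for \<alpha> :: cpoly3
proof
  show "\<alpha> = 3 * ([:[:[:1/3:]:]:] * \<alpha>)" by (simp add: numeral_poly flip: one_pCons)
qed

section \<open>The syzygies\<close>

text \<open>
  \<open>Y\<close> is the variable that occurs in all three factors of the curve. The form
  \<open>q \<alpha> \<beta> \<gamma>\<close> stands for \<open>\<alpha> X\<^sup>4 + \<beta> Y\<^sup>4 + \<gamma> Z\<^sup>4\<close>.
\<close>

locale permuted_variables =
  fixes X Y Z :: cpoly3 and DX DY DZ :: "cpoly3 \<Rightarrow> cpoly3"
    and q :: "complex \<Rightarrow> complex \<Rightarrow> complex \<Rightarrow> cpoly3"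
  assumes derivations: "derivation DX" "derivation DY" "derivation DZ"
    and D_vars: "DX X = 1" "DX Y = 0" "DX Z = 0" "DY X = 0" "DY Y = 1" "DY Z = 0"
      "DZ X = 0" "DZ Y = 0" "DZ Z = 1"
    and hom_vars: "homogeneous 1 X" "homogeneous 1 Y" "homogeneous 1 Z"
    and power4: "X ^ 4 = q 1 0 0" "Y ^ 4 = q 0 1 0" "Z ^ 4 = q 0 0 1"
    and q_add: "q \<alpha> \<beta> \<gamma> + q \<alpha>' \<beta>' \<gamma>' = q (\<alpha> + \<alpha>') (\<beta> + \<beta>') (\<gamma> + \<gamma>')"
    and q_numeral: "numeral n * q \<alpha> \<beta> \<gamma> = q (numeral n * \<alpha>) (numeral n * \<beta>) (numeral n * \<gamma>)"
    and q_coprime: "\<alpha>*\<beta>' \<noteq> \<alpha>'*\<beta> \<or> \<alpha>*\<gamma>' \<noteq> \<alpha>'*\<gamma> \<or> \<beta>*\<gamma>' \<noteq> \<beta>'*\<gamma> \<Longrightarrow>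
      coprime (q \<alpha> \<beta> \<gamma>) (q \<alpha>' \<beta>' \<gamma>')"
    and q_nonzero: "\<alpha> \<noteq> 0 \<or> \<beta> \<noteq> 0 \<or> \<gamma> \<noteq> 0 \<Longrightarrow> q \<alpha> \<beta> \<gamma> \<noteq> 0"
    and ideal_XZ: "A * Y ^ 3 = B * X + C * Z \<Longrightarrow> \<exists>B' C'. A = B' * X + C' * Z"
begin

abbreviation a where "a \<equiv> X ^ 4"
abbreviation b where "b \<equiv> Y ^ 4"
abbreviation c where "c \<equiv> Z ^ 4"

definition "curve = (a + b + c) * (a + b) * (b + c)"

definition "hX = X^3 * (b + c) * (2*a + 2*b + c)"
definition "hY = Y^3 * ((b + c) * (a + b + c) + (a + b) * (a + b + c) + (a + b) * (b + c))"
definition "hZ = Z^3 * (a + b) * (a + 2*b + 2*c)"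

text \<open>
  In the coordinates \<open>a, b, c\<close> the syzygy \<open>r1\<close> corresponds to a derivation that is logarithmic
  along the braid arrangement \<open>abc(a + b + c)(a + b)(b + c)\<close>; \<open>r2\<close> and \<open>r3\<close> correspond to
  logarithmic derivations of the subarrangements without \<open>bc\<close> and without \<open>ab\<close>.
\<close>

definition "r1X = X * (a + 3*b + 2*c)"
definition "r1Y = 2 * (Y * (c - a))"
definition "r1Z = - (Z * (2*a + 3*b + c))"

definition "r2X = X * Y^3 * Z^3"
definition "r2Y = - (Z^3 * (3*a + 2*b))"
definition "r2Z = Y^3 * (3*a + 3*b + c)"

definition "r3X = Y^3 * (a + 3*b + 3*c)"
definition "r3Y = - (X^3 * (2*b + 3*c))"
definition "r3Z = X^3 * Y^3 * Z"

lemmas h_defs = hX_def hY_def hZ_def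
lemmas r_defs = r1X_def r1Y_def r1Z_def r2X_def r2Y_def r2Z_def r3X_def r3Y_def r3Z_def

lemma vars_nonzero: "X \<noteq> 0" "Y \<noteq> 0" "Z \<noteq> 0"
  using D_vars derivations by (auto simp: derivation_0)

lemma partials_curve: "DX curve = 4 * hX" "DY curve = 4 * hY" "DZ curve = 4 * hZ"
proof -
  note P = derivation_power[where n = 3, simplified]
  have "DX a = 4 * X^3" "DX b = 0" "DX c = 0" "DY a = 0" "DY b = 4 * Y^3" "DY c = 0"
    "DZ a = 0" "DZ b = 0" "DZ c = 4 * Z^3"
    by (simp_all add: P[OF derivations(1)] P[OF derivations(2)] P[OF derivations(3)] D_vars)
  note D = derivations[THEN derivation_add] derivations[THEN derivation_mult] this
  show "DX curve = 4 * hX" "DY curve = 4 * hY" "DZ curve = 4 * hZ"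
    unfolding curve_def h_defs D by (simp_all add: algebra_simps eval_nat_numeral)
qed

section \<open>Degrees of the curve, its gradient and the syzygies\<close>

lemma homogeneous_quartics: "homogeneous 4 a" "homogeneous 4 b" "homogeneous 4 c"
  using hom_vars[THEN homogeneous_power[where n = 4]] by simp_all

lemma homogeneous_cubics: "homogeneous 3 (X^3)" "homogeneous 3 (Y^3)" "homogeneous 3 (Z^3)"
  using hom_vars[THEN homogeneous_power[where n = 3]] by simp_all

lemmas homogeneous_intros = homogeneous_quartics homogeneous_cubics hom_vars homogeneous_add
  homogeneous_diff homogeneous_uminus homogeneous_numeral_mult

lemma homogeneous_curve: "homogeneous 12 curve"
  unfolding curve_def
  by (rule homogeneous_mult_eq[where m = 8 and n = 4] homogeneous_mult_eq[where m = 4 and n = 4]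
      homogeneous_intros | simp)+

lemma homogeneous_h: "homogeneous 11 hX" "homogeneous 11 hY" "homogeneous 11 hZ"
  unfolding h_defs
  by (rule homogeneous_mult_eq[where m = 7 and n = 4 and k = 11]
      homogeneous_mult_eq[where m = 3 and n = 4 and k = 7]
      homogeneous_mult_eq[where m = 4 and n = 4 and k = 8]
      homogeneous_mult_eq[where m = 3 and n = 8 and k = 11] homogeneous_intros | simp)+

lemma homogeneous_r1: "homogeneous 5 r1X" "homogeneous 5 r1Y" "homogeneous 5 r1Z"
  unfolding r_defs
  by (rule homogeneous_intros homogeneous_mult_eq[where m = 1 and n = 4 and k = 5] | simp)+

lemma homogeneous_r2: "homogeneous 7 r2X" "homogeneous 7 r2Y" "homogeneous 7 r2Z"
  unfolding r_defs
  by (rule homogeneous_mult_eq[where m = 3 and n = 4 and k = 7]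
      homogeneous_mult_eq[where m = 1 and n = 3 and k = 4]
      homogeneous_mult_eq[where m = 4 and n = 3 and k = 7] homogeneous_intros | simp)+

lemma homogeneous_r3: "homogeneous 7 r3X" "homogeneous 7 r3Y" "homogeneous 7 r3Z"
  unfolding r_defs
  by (rule homogeneous_mult_eq[where m = 3 and n = 4 and k = 7]
      homogeneous_mult_eq[where m = 6 and n = 1 and k = 7]
      homogeneous_mult_eq[where m = 3 and n = 3 and k = 6] homogeneous_intros | simp)+

section \<open>Coprimality of gradient entries and squarefreeness of the curve\<close>

lemma hX_nonzero: "hX \<noteq> 0"
  unfolding hX_def power4 q_add q_numeral using vars_nonzero by (simp add: q_nonzero)

lemma coprime_vars: "coprime X Y" "coprime X Z" "coprime Y Z"
proof -
  have "coprime (X^4) (Y^4)" "coprime (X^4) (Z^4)" "coprime (Y^4) (Z^4)"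
    unfolding power4 by (rule q_coprime; simp)+
  thus "coprime X Y" "coprime X Z" "coprime Y Z" by simp_all
qed

text \<open>Every factor of \<open>hX\<close> is coprime to every factor of \<open>hZ\<close>: the
  quartic factors have pairwise independent coefficient vectors, and \<open>X\<close> (or
  \<open>Z\<close>) is coprime to each quartic that is not a multiple of \<open>a\<close> (or
  \<open>c\<close>).\<close>

lemma coprime_hX_hZ: "coprime hX hZ"
proof -
  have "coprime (X^4) (q \<alpha> \<beta> \<gamma>)" if "\<beta> \<noteq> 0 \<or> \<gamma> \<noteq> 0" for \<alpha> \<beta> \<gamma>
    unfolding power4 using that by (auto intro!: q_coprime)
  moreover have "coprime (q \<alpha> \<beta> \<gamma>) (Z^4)" if "\<alpha> \<noteq> 0 \<or> \<beta> \<noteq> 0" for \<alpha> \<beta> \<gamma>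
    unfolding power4 using that by (auto intro!: q_coprime)
  ultimately have v: "\<beta> \<noteq> 0 \<or> \<gamma> \<noteq> 0 \<Longrightarrow> coprime X (q \<alpha> \<beta> \<gamma>)"
    "\<alpha> \<noteq> 0 \<or> \<beta> \<noteq> 0 \<Longrightarrow> coprime (q \<alpha> \<beta> \<gamma>) Z" for \<alpha> \<beta> \<gamma> by simp_all
  show ?thesis
    unfolding hX_def hZ_def coprime_mult_left_iff coprime_mult_right_iff
    unfolding power4 q_add q_numeral
    by (simp add: coprime_vars v q_coprime)
qed

text \<open>If the square of \<open>p\<close> divides one of the three factors, then
  \<open>p\<close> divides two of its partial derivatives, which are 4 times cubes of different
  variables and hence coprime. The three factors are pairwise coprime.\<close>

lemma squarefree_curve: "squarefree curve"
proof -
  have sf: "squarefree L"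
    if "derivation D" "D L = 4 * v ^ 3" "derivation D'" "D' L = 4 * w ^ 3" "coprime v w"
    for D D' and L v w :: cpoly3
  proof (rule squarefreeI)
    fix p assume p: "p\<^sup>2 dvd L"
    have "1 = (4 :: cpoly3) * [:[:[:1/4:]:]:]" by (simp add: numeral_poly one_pCons)
    hence "(4 :: cpoly3) dvd 1" by (rule dvdI)
    hence "coprime (4 * v ^ 3) (4 * w ^ 3)" using that(5)
      by (simp add: coprime_mult_left_iff coprime_mult_right_iff is_unit_left_imp_coprime
          is_unit_right_imp_coprime)
    thus "p dvd 1"
      using derivation_square_dvd[OF that(1) p] derivation_square_dvd[OF that(3) p] that(2,4)
      by (metis coprime_common_divisor)
  qed
  note D = derivation_add derivation_power[where n = 3, simplified]
  note D' = D[OF derivations(1)] D[OF derivations(2)] D[OF derivations(3)] D_vars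
  have "squarefree (a + b + c)"
    by (rule sf[OF derivations(1) _ derivations(2) _ coprime_vars(1)]) (simp_all add: D')
  moreover have "squarefree (a + b)"
    by (rule sf[OF derivations(1) _ derivations(2) _ coprime_vars(1)]) (simp_all add: D')
  moreover have "squarefree (b + c)"
    by (rule sf[OF derivations(2) _ derivations(3) _ coprime_vars(3)]) (simp_all add: D')
  moreover have "coprime (a + b + c) (a + b)" "coprime (a + b + c) (b + c)" "coprime (a + b) (b + c)"
    unfolding power4 q_add by (rule q_coprime; simp)+
  ultimately show ?thesis unfolding curve_def
    by (intro squarefree_mult_coprime) (simp_all add: coprime_mult_left_iff)
qed

section \<open>First and second syzygies of the gradient\<close>

lemma cross_products:
  "r1Y*r2Z - r1Z*r2Y = - 3*X*hX" "r1Z*r2X - r1X*r2Z = - 3*X*hY" "r1X*r2Y - r1Y*r2X = - 3*X*hZ"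
  "r3Y*r1Z - r3Z*r1Y = 3*Z*hX" "r3Z*r1X - r3X*r1Z = 3*Z*hY" "r3X*r1Y - r3Y*r1X = 3*Z*hZ"
  "r2Y*r3Z - r2Z*r3Y = 3*Y^3*hX" "r2Z*r3X - r2X*r3Z = 3*Y^3*hY" "r2X*r3Y - r2Y*r3X = 3*Y^3*hZ"
  unfolding h_defs r_defs by (simp_all add: algebra_simps eval_nat_numeral)

lemma syzygies:
  "r1X*hX + r1Y*hY + r1Z*hZ = 0" "r2X*hX + r2Y*hY + r2Z*hZ = 0" "r3X*hX + r3Y*hY + r3Z*hZ = 0"
  unfolding h_defs r_defs by (simp_all add: algebra_simps eval_nat_numeral)

text \<open>The matrix with columns \<open>r1\<close>, \<open>r2\<close>, \<open>r3\<close> has rank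
  two, is annihilated by \<open>h\<close> from the left and by \<open>(Y^3, Z, -X)\<close> from the
  right. Its adjugate is therefore proportional to the outer product of these vectors, which
  explains the shape of \<open>cross_products\<close>.\<close>

lemma second_syzygy:
  "X * r3X = Y^3 * r1X + Z * r2X" "X * r3Y = Y^3 * r1Y + Z * r2Y" "X * r3Z = Y^3 * r1Z + Z * r2Z"
  unfolding r_defs by (simp_all add: algebra_simps eval_nat_numeral)

text \<open>\<open>Y^3\<close> is a nonzerodivisor modulo \<open>(X, Z)\<close>, which gives the
  form of \<open>A\<close>; after substitution, coprimality of \<open>X\<close> and \<open>Z\<close>
  gives that of \<open>B\<close>.\<close>

lemma koszul:
  assumes "A * Y^3 + B * Z + C * X = 0"
  shows "\<exists>\<alpha> \<beta> \<delta>. A = \<alpha> * X + \<beta> * Z \<and> B = \<delta> * X - \<beta> * Y^3"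
proof -
  have "A * Y^3 = (- C) * X + (- B) * Z" using assms by (simp add: algebra_simps eq_neg_iff_add_eq_0)
  then obtain \<alpha> \<beta> where A: "A = \<alpha> * X + \<beta> * Z" using ideal_XZ by blast
  have "Z * (B + \<beta> * Y^3) = - (X * (\<alpha> * Y^3 + C))"
    using assms unfolding A by (simp add: algebra_simps eq_neg_iff_add_eq_0)
  hence "X dvd Z * (B + \<beta> * Y^3)" by (metis dvd_minus_iff dvd_triv_left)
  hence "X dvd B + \<beta> * Y^3" using coprime_vars(2) by (simp add: coprime_dvd_mult_right_iff)
  then obtain \<delta> where "B + \<beta> * Y^3 = \<delta> * X" by (metis dvdE mult.commute)
  thus ?thesis using A by (metis add_diff_cancel_right')
qed

lemma cross_product_nonzero: "r1Y*r2Z - r1Z*r2Y \<noteq> 0"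
  unfolding cross_products using vars_nonzero hX_nonzero by simp

lemma syzygies_generated:
  assumes s: "P * hX + Q * hY + R * hZ = 0"
  shows "\<exists>c1 c2 c3. P = c1*r1X + c2*r2X + c3*r3X \<and> Q = c1*r1Y + c2*r2Y + c3*r3Y \<and>
    R = c1*r1Z + c2*r2Z + c3*r3Z"
proof -
  note cp = cross_product_parallel[OF coprime_hX_hZ hX_nonzero s]
  obtain l1 where l1: "Q*r1Z - R*r1Y = l1*hX" "R*r1X - P*r1Z = l1*hY" "P*r1Y - Q*r1X = l1*hZ"
    using cp[OF syzygies(1)] by blast
  obtain l2 where l2: "Q*r2Z - R*r2Y = l2*hX" "R*r2X - P*r2Z = l2*hY" "P*r2Y - Q*r2X = l2*hZ"
    using cp[OF syzygies(2)] by blast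
  obtain l3 where l3: "Q*r3Z - R*r3Y = l3*hX"
    using cp[OF syzygies(3)] by blast
  \<comment> \<open>Take the cross product of \<open>(P, Q, R)\<close> with the relation between
    \<open>r1\<close>, \<open>r2\<close>, \<open>r3\<close>; its first component suffices to obtain
    the relation between \<open>l1\<close>, \<open>l2\<close>, \<open>l3\<close>.\<close>
  have "(l1 * Y^3 + l2 * Z + (- l3) * X) * hX = Y^3 * (l1*hX) + Z * (l2*hX) - X * (l3*hX)"
    by (simp add: algebra_simps)
  also have "\<dots> = Q * (Y^3*r1Z + Z*r2Z - X*r3Z) - R * (Y^3*r1Y + Z*r2Y - X*r3Y)"
    unfolding l1(1)[symmetric] l2(1)[symmetric] l3[symmetric] by (simp add: algebra_simps)
  also have "\<dots> = 0" unfolding second_syzygy by simp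
  finally have "l1 * Y^3 + l2 * Z + (- l3) * X = 0" using hX_nonzero by simp
  then obtain \<alpha> \<beta> \<delta> where "l1 = (3*\<alpha>) * X + (3*\<beta>) * Z" "l2 = (3*\<delta>) * X - (3*\<beta>) * Y^3"
    using koszul ex_third by metis
  note l = this l1 l2
  \<comment> \<open>By \<open>cross_products\<close>, the subtracted combination has the same cross
    products with \<open>r1\<close> and \<open>r2\<close> as \<open>(P, Q, R)\<close>, so those of
    the remainder \<open>(p, q, r)\<close> vanish.\<close>
  define p where "p = P - (- \<delta>*r1X + \<alpha>*r2X + \<beta>*r3X)"
  define q where "q = Q - (- \<delta>*r1Y + \<alpha>*r2Y + \<beta>*r3Y)"
  define r where "r = R - (- \<delta>*r1Z + \<alpha>*r2Z + \<beta>*r3Z)"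
  note pqr = p_def q_def r_def
  have 1: "q*r1Z - r*r1Y = 0" "r*r1X - p*r1Z = 0" "p*r1Y - q*r1X = 0"
  proof -
    have "q*r1Z - r*r1Y = (Q*r1Z - R*r1Y) + \<alpha>*(r1Y*r2Z - r1Z*r2Y) - \<beta>*(r3Y*r1Z - r3Z*r1Y)"
      unfolding pqr by (simp add: algebra_simps)
    thus "q*r1Z - r*r1Y = 0" unfolding cross_products l by (simp add: algebra_simps)
    have "r*r1X - p*r1Z = (R*r1X - P*r1Z) + \<alpha>*(r1Z*r2X - r1X*r2Z) - \<beta>*(r3Z*r1X - r3X*r1Z)"
      unfolding pqr by (simp add: algebra_simps)
    thus "r*r1X - p*r1Z = 0" unfolding cross_products l by (simp add: algebra_simps)
    have "p*r1Y - q*r1X = (P*r1Y - Q*r1X) + \<alpha>*(r1X*r2Y - r1Y*r2X) - \<beta>*(r3X*r1Y - r3Y*r1X)"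
      unfolding pqr by (simp add: algebra_simps)
    thus "p*r1Y - q*r1X = 0" unfolding cross_products l by (simp add: algebra_simps)
  qed
  have 2: "q*r2Z - r*r2Y = 0"
  proof -
    have "q*r2Z - r*r2Y = (Q*r2Z - R*r2Y) + \<delta>*(r1Y*r2Z - r1Z*r2Y) + \<beta>*(r2Y*r3Z - r2Z*r3Y)"
      unfolding pqr by (simp add: algebra_simps)
    thus ?thesis unfolding cross_products l by (simp add: algebra_simps)
  qed
  \<comment> \<open>The first component of \<open>r1 \<times> r2\<close> is nonzero, and multiplying
    the remainder by it gives combinations of the vanishing cross products.\<close>
  have "p * (r1Y*r2Z - r1Z*r2Y) = (p*r1Y - q*r1X)*r2Z + (r*r1X - p*r1Z)*r2Y + r1X*(q*r2Z - r*r2Y)"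
    "q * (r1Y*r2Z - r1Z*r2Y) = r1Y*(q*r2Z - r*r2Y) - (q*r1Z - r*r1Y)*r2Y"
    "r * (r1Y*r2Z - r1Z*r2Y) = r1Z*(q*r2Z - r*r2Y) - (q*r1Z - r*r1Y)*r2Z"
    by (simp_all add: algebra_simps)
  hence "p = 0" "q = 0" "r = 0" unfolding 1 2 using cross_product_nonzero by simp_all
  hence "P = - \<delta>*r1X + \<alpha>*r2X + \<beta>*r3X" "Q = - \<delta>*r1Y + \<alpha>*r2Y + \<beta>*r3Y"
    "R = - \<delta>*r1Z + \<alpha>*r2Z + \<beta>*r3Z" unfolding pqr by simp_all
  thus ?thesis by blast
qed

text \<open>The cross product of the relation with \<open>r1\<close> gives
  \<open>X * c2 + Z * c3 = 0\<close>, so \<open>X\<close> divides \<open>c3\<close>, and the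
  quotient is \<open>n\<close>. The cross product with \<open>r2\<close> then determines
  \<open>c1\<close>.\<close>

lemma second_syzygies_generated:
  assumes "c1*r1X + c2*r2X + c3*r3X = 0" "c1*r1Y + c2*r2Y + c3*r3Y = 0" "c1*r1Z + c2*r2Z + c3*r3Z = 0"
  shows "\<exists>n. c1 = - (Y^3) * n \<and> c2 = - Z * n \<and> c3 = X * n"
proof -
  have "(c1*r1Y + c2*r2Y + c3*r3Y)*r1Z - (c1*r1Z + c2*r2Z + c3*r3Z)*r1Y =
      c3*(r3Y*r1Z - r3Z*r1Y) - c2*(r1Y*r2Z - r1Z*r2Y)"
    by (simp add: algebra_simps)
  hence "(3 * hX) * (X * c2 + Z * c3) = 0"
    unfolding assms cross_products by (simp add: algebra_simps)
  hence 23: "X * c2 + Z * c3 = 0" using hX_nonzero by simp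
  hence "Z * c3 = X * (- c2)" by (simp add: eq_neg_iff_add_eq_0 add.commute)
  hence "X dvd Z * c3" by simp
  hence "X dvd c3" using coprime_vars(2) by (simp add: coprime_dvd_mult_right_iff)
  then obtain n where n: "c3 = X * n" by (auto simp: dvd_def)
  have "X * (c2 + Z * n) = 0" using 23 unfolding n by (simp add: algebra_simps)
  hence 2: "c2 = - Z * n" using vars_nonzero by (simp add: eq_neg_iff_add_eq_0)
  have "- (3 * X * hX) * (c1 + Y^3 * n) = c1*(r1Y*r2Z - r1Z*r2Y) - c3*(r2Y*r3Z - r2Z*r3Y)"
    unfolding cross_products n by (simp add: algebra_simps)
  also have "\<dots> = (c1*r1Y + c2*r2Y + c3*r3Y)*r2Z - (c1*r1Z + c2*r2Z + c3*r3Z)*r2Y"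
    by (simp add: algebra_simps)
  finally have "- (3 * X * hX) * (c1 + Y^3 * n) = 0" unfolding assms by simp
  hence "c1 + Y^3 * n = 0" using hX_nonzero vars_nonzero by simp
  hence "c1 = - (Y^3) * n" by (simp add: eq_neg_iff_add_eq_0)
  thus ?thesis using 2 n by blast
qed

lemma syzygies_iff:
  "P * (4 * hX) + Q * (4 * hY) + R * (4 * hZ) = 0 \<longleftrightarrow>
    (\<exists>c1 c2 c3. P = c1*r1X + c2*r2X + c3*r3X \<and> Q = c1*r1Y + c2*r2Y + c3*r3Y \<and>
      R = c1*r1Z + c2*r2Z + c3*r3Z)" (is "_ \<longleftrightarrow> ?rhs")
proof
  assume "P * (4 * hX) + Q * (4 * hY) + R * (4 * hZ) = 0"
  hence "4 * (P * hX + Q * hY + R * hZ) = 0" by (simp add: algebra_simps)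
  hence "P * hX + Q * hY + R * hZ = 0" by (metis mult_eq_0_iff zero_neq_numeral)
  thus ?rhs by (rule syzygies_generated)
next
  assume ?rhs
  then obtain c1 c2 c3 where "P = c1*r1X + c2*r2X + c3*r3X" "Q = c1*r1Y + c2*r2Y + c3*r3Y"
    "R = c1*r1Z + c2*r2Z + c3*r3Z" by blast
  hence "P * (4 * hX) + Q * (4 * hY) + R * (4 * hZ) = 4 * (c1 * (r1X*hX + r1Y*hY + r1Z*hZ) +
      c2 * (r2X*hX + r2Y*hY + r2Z*hZ) + c3 * (r3X*hX + r3Y*hY + r3Z*hZ))"
    by (simp add: algebra_simps)
  thus "P * (4 * hX) + Q * (4 * hY) + R * (4 * hZ) = 0" by (simp add: syzygies)
qed

lemma second_syzygies_iff:
  "c1*r1X + c2*r2X + c3*r3X = 0 \<and> c1*r1Y + c2*r2Y + c3*r3Y = 0 \<and> c1*r1Z + c2*r2Z + c3*r3Z = 0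
    \<longleftrightarrow> (\<exists>n. c1 = - (Y^3) * n \<and> c2 = - Z * n \<and> c3 = X * n)" (is "?lhs \<longleftrightarrow> ?rhs")
proof
  assume ?rhs
  then obtain n where "c1 = - (Y^3) * n" "c2 = - Z * n" "c3 = X * n" by blast
  hence "c1*r + c2*s + c3*t = n * (X * t - (Y^3 * r + Z * s))" for r s t
    by (simp add: algebra_simps)
  thus ?lhs by (simp add: second_syzygy)
qed (use second_syzygies_generated in blast)

text \<open>These are the entries of the last map; their degrees 3, 1, 1 are 19 + 1 - 12 - d for d =
  5, 7, 7.\<close>

lemma homogeneous_k: "homogeneous 3 (- (Y^3))" "homogeneous 1 (- Z)" "homogeneous 1 X"
  using homogeneous_cubics(2) hom_vars by (simp_all add: homogeneous_uminus)

end

section \<open>Resolutions with three first syzygies\<close>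

text \<open>Writing vectors as explicit lists turns equations between images and kernels into
  equations between polynomials.\<close>

lemma carrier_vec_3: "v \<in> carrier_vec 3 \<longleftrightarrow> (\<exists>a b c. v = vec_of_list [a, b, c])"
proof
  assume "v \<in> carrier_vec 3"
  hence "v = vec_of_list [v $ 0, v $ 1, v $ 2]"
    by (intro eq_vecI) (auto simp: eval_nat_numeral less_Suc_eq vec_of_list_index)
  thus "\<exists>a b c. v = vec_of_list [a, b, c]" by blast
qed (auto intro!: carrier_vecI simp del: vec_of_list_Cons)

lemma carrier_vec_1: "v \<in> carrier_vec 1 \<longleftrightarrow> (\<exists>a. v = vec_of_list [a])"
proof
  assume "v \<in> carrier_vec 1"
  hence "v = vec_of_list [v $ 0]" by (intro eq_vecI) (auto simp: vec_of_list_index)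
  thus "\<exists>a. v = vec_of_list [a]" by blast
qed (auto intro!: carrier_vecI simp del: vec_of_list_Cons)

lemma vec_of_list_eq_iff: "vec_of_list xs = vec_of_list ys \<longleftrightarrow> xs = ys"
  by (metis list_vec)

lemma zero_vec_of_list: "0\<^sub>v 1 = vec_of_list [0]" "0\<^sub>v 3 = vec_of_list [0, 0, 0]"
  by (auto intro!: eq_vecI simp: numeral_3_eq_3 less_Suc_eq vec_of_list_index)

lemma mult_mat_vec_of_list:
  fixes a b c :: "'a::comm_semiring_0"
  shows "mat_of_rows_list 3 rs *\<^sub>v vec_of_list [a, b, c] =
      vec_of_list (map (\<lambda>r. a * r ! 0 + b * r ! 1 + c * r ! 2) rs)"
    and "mat_of_rows_list 1 rs *\<^sub>v vec_of_list [a] = vec_of_list (map (\<lambda>r. r ! 0 * a) rs)"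
  by (rule eq_vecI; simp add: mat_of_rows_list_def scalar_prod_def vec_of_list_index eval_nat_numeral
      ac_simps del: vec_of_list_Cons)+

lemma nth_explicit: "[p, q, r] ! 0 = p" "[p, q, r] ! 1 = q" "[p, q, r] ! 2 = r" "[p] ! 0 = p"
  by simp_all

lemma mat_image_3: "dim_col A = 3 \<Longrightarrow> mat_image A = {A *\<^sub>v vec_of_list [a, b, c] | a b c. True}"
  and mat_image_1: "dim_col A = 1 \<Longrightarrow> mat_image A = {A *\<^sub>v vec_of_list [a] | a. True}"
  unfolding mat_image_def by
    (auto simp: carrier_vec_3 carrier_vec_1 simp del: vec_of_list_Cons One_nat_def)

lemma mat_kernel_3:
  "dim_col A = 3 \<Longrightarrow>
    mat_kernel A = {vec_of_list [a, b, c] | a b c. A *\<^sub>v vec_of_list [a, b, c] = 0\<^sub>v (dim_row A)}"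
  unfolding mat_kernel_def by (auto simp: carrier_vec_3 simp del: vec_of_list_Cons)

text \<open>Different twists force each entry to be homogeneous of nonzero degree, so it has no
  constant term.\<close>

lemma minimal_map_if_graded:
  assumes "graded_map bs as A" "\<And>s t. s \<in> set as \<Longrightarrow> t \<in> set bs \<Longrightarrow> s \<noteq> t"
  shows "minimal_map A"
  unfolding minimal_map_def
proof (intro allI impI)
  fix i j assume "i < dim_row A" "j < dim_col A"
  hence ij: "i < length as" "j < length bs" using assms(1) by (auto simp: graded_map_def)
  hence "homogeneous (as ! i - bs ! j) (A $$ (i, j))" using assms(1) by (simp add: graded_map_def)
  hence "coeff (coeff (coeff (A $$ (i, j)) 0) 0) 0 \<noteq> 0 \<longrightarrow> int (0 + 0 + 0) = as ! i - bs ! j"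
    unfolding homogeneous_def by blast
  moreover have "as ! i \<noteq> bs ! j" using assms(2) ij by simp
  ultimately show "coeff (coeff (coeff (A $$ (i, j)) 0) 0) 0 = 0" by auto
qed

text \<open>The syzygies \<open>u\<close>, \<open>v\<close>, \<open>w\<close> are the columns of the
  second matrix and \<open>k\<close> is the only column of the third. Exactness is
  \<open>syz\<close> and \<open>syz2\<close>; \<open>k3 \<noteq> 0\<close> makes the last map
  injective, and the inequalities between the degrees give minimality.\<close>

lemma milnor_resolutionI:
  assumes hom_f: "homogeneous (int d - 1) (partial_x f)" "homogeneous (int d - 1) (partial_y f)"
      "homogeneous (int d - 1) (partial_z f)"
    and hom_u: "homogeneous (int d1) u1" "homogeneous (int d1) u2" "homogeneous (int d1) u3"
    and hom_v: "homogeneous (int d2) v1" "homogeneous (int d2) v2" "homogeneous (int d2) v3"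
    and hom_w: "homogeneous (int d3) w1" "homogeneous (int d3) w2" "homogeneous (int d3) w3"
    and hom_k: "homogeneous (int e + 1 - int d - int d1) k1"
      "homogeneous (int e + 1 - int d - int d2) k2" "homogeneous (int e + 1 - int d - int d3) k3"
    and degrees: "1 < d" "0 < d1" "0 < d2" "0 < d3" "d + d1 \<le> e" "d + d2 \<le> e" "d + d3 \<le> e"
    and syz: "\<And>P Q R. P * partial_x f + Q * partial_y f + R * partial_z f = 0 \<longleftrightarrow>
      (\<exists>c1 c2 c3. P = c1*u1 + c2*v1 + c3*w1 \<and> Q = c1*u2 + c2*v2 + c3*w2 \<and>
        R = c1*u3 + c2*v3 + c3*w3)"
    and syz2: "\<And>c1 c2 c3. c1*u1 + c2*v1 + c3*w1 = 0 \<and> c1*u2 + c2*v2 + c3*w2 = 0 \<and>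
      c1*u3 + c2*v3 + c3*w3 = 0 \<longleftrightarrow> (\<exists>n. c1 = k1 * n \<and> c2 = k2 * n \<and> c3 = k3 * n)"
    and "k3 \<noteq> 0"
  shows "milnor_resolution d f [d1, d2, d3] [e]"
proof -
  define A1 where "A1 = mat_of_rows_list 3 [[partial_x f, partial_y f, partial_z f]]"
  define A2 where "A2 = mat_of_rows_list 3 [[u1, v1, w1], [u2, v2, w2], [u3, v3, w3]]"
  define A3 where "A3 = mat_of_rows_list 1 [[k1], [k2], [k3]]"
  let ?s = "replicate 3 (1 - int d)" and ?t = "map (\<lambda>di. 1 - int d - int di) [d1, d2, d3]"
    and ?u = "map (\<lambda>e. - int e) [e]"
  have dims: "dim_col A1 = 3" "dim_row A1 = 1" "dim_col A2 = 3" "dim_row A2 = 3"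
    "dim_col A3 = 1" "dim_row A3 = 3"
    by (simp_all add: A1_def A2_def A3_def mat_of_rows_list_def)
  have "A1 \<in> carrier_mat 1 3" "A2 \<in> carrier_mat 3 3" "A3 \<in> carrier_mat 3 1"
    by (intro carrier_matI dims)+
  hence g: "graded_map ?s [0] A1" "graded_map ?t ?s A2" "graded_map ?u ?t A3"
    using assms(1-15)
    by (simp_all add: graded_map_def A1_def A2_def A3_def mat_of_rows_list_def numeral_3_eq_3
        All_less_Suc2 algebra_simps)
  moreover have "minimal_map A1"
    by (rule minimal_map_if_graded[OF g(1)]) (use degrees in simp)
  moreover have "minimal_map A2"
    by (rule minimal_map_if_graded[OF g(2)]) (use degrees in auto)
  moreover have "minimal_map A3"
    by (rule minimal_map_if_graded[OF g(3)]) (use degrees in auto)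
  moreover have "mat_image A1 = {v \<in> carrier_vec 1. v $ 0 \<in> jacobian_ideal f}"
  proof -
    have "mat_image A1 = {vec_of_list [p] | p. p \<in> jacobian_ideal f}"
      unfolding mat_image_3[OF dims(1)]
      unfolding A1_def mult_mat_vec_of_list list.map nth_explicit jacobian_ideal_def by blast
    also have "\<dots> = {v \<in> carrier_vec 1. v $ 0 \<in> jacobian_ideal f}"
      unfolding carrier_vec_1 by (auto simp: vec_of_list_index simp del: vec_of_list_Cons)
    finally show ?thesis .
  qed
  moreover have "mat_image A2 = mat_kernel A1"
    unfolding mat_image_3[OF dims(3)] mat_kernel_3[OF dims(1)] dims zero_vec_of_list
    unfolding A1_def A2_def mult_mat_vec_of_list list.map nth_explicit vec_of_list_eq_iff
    by (auto simp: syz) blast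
  moreover have "mat_image A3 = mat_kernel A2"
    unfolding mat_image_1[OF dims(5)] mat_kernel_3[OF dims(3)] dims zero_vec_of_list
    unfolding A2_def A3_def mult_mat_vec_of_list list.map nth_explicit vec_of_list_eq_iff list.inject
    by (auto simp: syz2)
  moreover have "mat_kernel A3 = {0\<^sub>v (length [e])}"
  proof -
    have "length [e] = 1" by simp
    thus ?thesis
      unfolding mat_kernel_def dims carrier_vec_1 using \<open>k3 \<noteq> 0\<close>
      by (auto simp: A3_def mult_mat_vec_of_list list.map nth_explicit vec_of_list_eq_iff
          zero_vec_of_list simp del: vec_of_list_Cons One_nat_def list.size)
  qed
  ultimately show ?thesis unfolding milnor_resolution_def by blast
qed

section \<open>Ideals generated by two variables\<close>

text \<open>In each layer, divisibility by the variable means a zero constant coefficient;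
  divisibility by a constant polynomial is tested coefficientwise.\<close>

lemma var_dvd_iff:
  "var_x dvd A \<longleftrightarrow> (\<forall>j k. coeff (coeff (coeff A k) j) 0 = 0)"
  "var_y dvd A \<longleftrightarrow> (\<forall>i k. coeff (coeff (coeff A k) 0) i = 0)"
  "var_z dvd A \<longleftrightarrow> (\<forall>i j. coeff (coeff (coeff A 0) j) i = 0)"
proof -
  have *: "[:0, 1:] dvd p \<longleftrightarrow> coeff p 0 = 0" for p :: "'a::comm_ring_1 poly"
    using poly_eq_0_iff_dvd[of p 0] by (simp add: poly_0_coeff_0)
  show "var_x dvd A \<longleftrightarrow> (\<forall>j k. coeff (coeff (coeff A k) j) 0 = 0)"
    "var_y dvd A \<longleftrightarrow> (\<forall>i k. coeff (coeff (coeff A k) 0) i = 0)"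
    "var_z dvd A \<longleftrightarrow> (\<forall>i j. coeff (coeff (coeff A 0) j) i = 0)"
    by (auto simp: var_x_def var_y_def var_z_def const_poly_dvd_iff * poly_eq_iff)
qed

lemma coeff_mult_var_power:
  "coeff (coeff (coeff (A * var_x ^ n) k) j) (i + n) = coeff (coeff (coeff A k) j) i"
  "coeff (coeff (coeff (A * var_y ^ n) k) (j + n)) i = coeff (coeff (coeff A k) j) i"
  "coeff (coeff (coeff (A * var_z ^ n) (k + n)) j) i = coeff (coeff (coeff A k) j) i"
proof -
  have "var_x ^ n = [:[:monom 1 n:]:]" "var_y ^ n = [:monom 1 n:]" "var_z ^ n = monom 1 n"
    by (simp_all add: var_x_def var_y_def var_z_def poly_const_pow monom_altdef flip: one_pCons)
  thus "coeff (coeff (coeff (A * var_x ^ n) k) j) (i + n) = coeff (coeff (coeff A k) j) i"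
    "coeff (coeff (coeff (A * var_y ^ n) k) (j + n)) i = coeff (coeff (coeff A k) j) i"
    "coeff (coeff (coeff (A * var_z ^ n) (k + n)) j) i = coeff (coeff (coeff A k) j) i"
    by (simp_all add: mult.commute[of A] coeff_monom_mult)
qed

lemma ideal_if_split:
  fixes v w :: "'a::comm_ring_1"
  assumes "v dvd S" "w dvd A - S"
  shows "\<exists>B C. A = B * v + C * w"
proof -
  obtain B C where "S = v * B" "A - S = w * C" using assms by (elim dvdE)
  hence "A = B * v + C * w" by (simp add: algebra_simps)
  thus ?thesis by blast
qed

text \<open>Modulo x and z, multiplication by y^3 merely shifts coefficients, so \<open>A\<close>
  has no pure powers of y. Its z-free part \<open>S\<close> is then divisible by x, and the rest by
  z.\<close>

lemma ideal_xz: "A * var_y ^ 3 = B * var_x + C * var_z \<Longrightarrow> \<exists>B' C'. A = B' * var_x + C' * var_z"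
proof (rule ideal_if_split[where S = "[:coeff A 0:]"])
  assume "A * var_y ^ 3 = B * var_x + C * var_z"
  hence "coeff (coeff (coeff A 0) j) 0 = 0" for j
    using coeff_mult_var_power(2)[of A 3 0 j 0] var_dvd_iff(1)[of "B * var_x"]
      var_dvd_iff(3)[of "C * var_z"]
    by simp
  thus "var_x dvd [:coeff A 0:]" by (simp add: var_dvd_iff coeff_pCons split: nat.splits)
qed (simp add: var_dvd_iff)

lemma ideal_yz: "A * var_x ^ 3 = B * var_y + C * var_z \<Longrightarrow> \<exists>B' C'. A = B' * var_y + C' * var_z"
proof (rule ideal_if_split[where S = "[:coeff A 0:]"])
  assume "A * var_x ^ 3 = B * var_y + C * var_z"
  hence "coeff (coeff (coeff A 0) 0) i = 0" for i
    using coeff_mult_var_power(1)[of A 3 0 0 i] var_dvd_iff(2)[of "B * var_y"]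
      var_dvd_iff(3)[of "C * var_z"]
    by simp
  thus "var_y dvd [:coeff A 0:]" by (simp add: var_dvd_iff coeff_pCons split: nat.splits)
qed (simp add: var_dvd_iff)

text \<open>Here the split is at the middle layer: \<open>S\<close> is the y-free part of
  \<open>A\<close>, divisible by x, and the rest is divisible by y.\<close>

lemma ideal_xy: "A * var_z ^ 3 = B * var_x + C * var_y \<Longrightarrow> \<exists>B' C'. A = B' * var_x + C' * var_y"
proof (rule ideal_if_split[where S = "map_poly (\<lambda>q. [:coeff q 0:]) A"])
  assume "A * var_z ^ 3 = B * var_x + C * var_y"
  hence "coeff (coeff (coeff A k) 0) 0 = 0" for k
    using coeff_mult_var_power(3)[of A 3 k 0 0] var_dvd_iff(1)[of "B * var_x"]
      var_dvd_iff(2)[of "C * var_y"]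
    by simp
  thus "var_x dvd map_poly (\<lambda>q. [:coeff q 0:]) A"
    by (simp add: var_dvd_iff coeff_map_poly coeff_pCons split: nat.splits)
qed (simp add: var_dvd_iff coeff_map_poly)

lemma quartic_form_nonzero: "\<alpha> \<noteq> 0 \<or> \<beta> \<noteq> 0 \<or> \<gamma> \<noteq> 0 \<Longrightarrow> quartic_form \<alpha> \<beta> \<gamma> \<noteq> 0"
proof
  assume *: "quartic_form \<alpha> \<beta> \<gamma> = 0" "\<alpha> \<noteq> 0 \<or> \<beta> \<noteq> 0 \<or> \<gamma> \<noteq> 0"
  have "[:monom \<alpha> 4:] + monom [:\<beta>:] 4 = 0" "[:[:\<gamma>:]:] = 0"
    using arg_cong[OF *(1), of "\<lambda>p. coeff p 0"] arg_cong[OF *(1), of "\<lambda>p. coeff p 4"]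
    by (simp_all add: quartic_form_def coeff_pCons split: nat.splits)
  thus False using *(2) by (simp add: binary_form_eq_0_iff)
qed

section \<open>The three curves as permutations of one another\<close>

interpretation C1: permuted_variables var_x var_y var_z partial_x partial_y partial_z quartic_form
  by unfold_locales
    (simp_all add: derivation_partials partials_of_vars homogeneous_vars vars_power4
      quartic_form_algebra coprime_quartic_forms quartic_form_nonzero ideal_xz)

text \<open>The variable common to all factors is x, which takes the place of \<open>Y\<close>; the
  arguments of the form are swapped accordingly.\<close>

interpretation C2: permuted_variables var_y var_x var_z partial_y partial_x partial_z
    "\<lambda>\<alpha> \<beta> \<gamma>. quartic_form \<beta> \<alpha> \<gamma>"
  by unfold_locales
    (use coprime_quartic_forms in \<open>auto simp: derivation_partials partials_of_vars homogeneous_vars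
      vars_power4 quartic_form_algebra quartic_form_nonzero mult.commute intro: ideal_yz\<close>)

interpretation C3: permuted_variables var_x var_z var_y partial_x partial_z partial_y
    "\<lambda>\<alpha> \<beta> \<gamma>. quartic_form \<alpha> \<gamma> \<beta>"
  by unfold_locales
    (use coprime_quartic_forms in \<open>auto simp: derivation_partials partials_of_vars homogeneous_vars
      vars_power4 quartic_form_algebra quartic_form_nonzero mult.commute intro: ideal_xy\<close>)

lemma curves_eq: "curve_C1 = C1.curve" "curve_C2 = C2.curve" "curve_C3 = C3.curve"
  by (simp_all add: curve_C1_def curve_C2_def curve_C3_def C1.curve_def C2.curve_def C3.curve_def ac_simps)

lemma syzygy_curve_C1: "syzygy_curve 3 12 curve_C1 [5, 7, 7] [19]"
proof -
  have "milnor_resolution 12 C1.curve [5, 7, 7] [19]"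
  proof (rule milnor_resolutionI)
    show "P * partial_x C1.curve + Q * partial_y C1.curve + R * partial_z C1.curve = 0 \<longleftrightarrow>
        (\<exists>c1 c2 c3. P = c1*C1.r1X + c2*C1.r2X + c3*C1.r3X \<and> Q = c1*C1.r1Y + c2*C1.r2Y + c3*C1.r3Y \<and>
          R = c1*C1.r1Z + c2*C1.r2Z + c3*C1.r3Z)" for P Q R
      using C1.syzygies_iff[of P Q R] unfolding C1.partials_curve by blast
    show "c1*C1.r1X + c2*C1.r2X + c3*C1.r3X = 0 \<and> c1*C1.r1Y + c2*C1.r2Y + c3*C1.r3Y = 0 \<and>
        c1*C1.r1Z + c2*C1.r2Z + c3*C1.r3Z = 0 \<longleftrightarrow>
        (\<exists>n. c1 = - (var_y ^ 3) * n \<and> c2 = - var_z * n \<and> c3 = var_x * n)" for c1 c2 c3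
      using C1.second_syzygies_iff[of c1 c2 c3] by blast
  qed (simp_all add: C1.partials_curve C1.homogeneous_h C1.homogeneous_r1 C1.homogeneous_r2
      C1.homogeneous_r3 C1.homogeneous_k C1.vars_nonzero homogeneous_numeral_mult)
  thus ?thesis
    by (simp add: syzygy_curve_def reduced_curve_def curves_eq C1.homogeneous_curve C1.squarefree_curve)
qed

lemma syzygy_curve_C2: "syzygy_curve 3 12 curve_C2 [5, 7, 7] [19]"
proof -
  have "milnor_resolution 12 C2.curve [5, 7, 7] [19]"
  proof (rule milnor_resolutionI)
    \<comment> \<open>The rows follow the order x, y, z, so the \<open>Y\<close> components of the
      syzygies come first.\<close>
    show "P * partial_x C2.curve + Q * partial_y C2.curve + R * partial_z C2.curve = 0 \<longleftrightarrow>
        (\<exists>c1 c2 c3. P = c1*C2.r1Y + c2*C2.r2Y + c3*C2.r3Y \<and> Q = c1*C2.r1X + c2*C2.r2X + c3*C2.r3X \<and>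
          R = c1*C2.r1Z + c2*C2.r2Z + c3*C2.r3Z)" for P Q R
      using C2.syzygies_iff[of Q P R] unfolding C2.partials_curve add.commute[of "P * _"] by blast
    show "c1*C2.r1Y + c2*C2.r2Y + c3*C2.r3Y = 0 \<and> c1*C2.r1X + c2*C2.r2X + c3*C2.r3X = 0 \<and>
        c1*C2.r1Z + c2*C2.r2Z + c3*C2.r3Z = 0 \<longleftrightarrow>
        (\<exists>n. c1 = - (var_x ^ 3) * n \<and> c2 = - var_z * n \<and> c3 = var_y * n)" for c1 c2 c3
      using C2.second_syzygies_iff[of c1 c2 c3] by blast
  qed (simp_all add: C2.partials_curve C2.homogeneous_h C2.homogeneous_r1 C2.homogeneous_r2
      C2.homogeneous_r3 C2.homogeneous_k C2.vars_nonzero homogeneous_numeral_mult)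
  thus ?thesis
    by (simp add: syzygy_curve_def reduced_curve_def curves_eq C2.homogeneous_curve C2.squarefree_curve)
qed

lemma syzygy_curve_C3: "syzygy_curve 3 12 curve_C3 [5, 7, 7] [19]"
proof -
  have "milnor_resolution 12 C3.curve [5, 7, 7] [19]"
  proof (rule milnor_resolutionI)
    show "P * partial_x C3.curve + Q * partial_y C3.curve + R * partial_z C3.curve = 0 \<longleftrightarrow>
        (\<exists>c1 c2 c3. P = c1*C3.r1X + c2*C3.r2X + c3*C3.r3X \<and> Q = c1*C3.r1Z + c2*C3.r2Z + c3*C3.r3Z \<and>
          R = c1*C3.r1Y + c2*C3.r2Y + c3*C3.r3Y)" for P Q R
      using C3.syzygies_iff[of P R Q] unfolding C3.partials_curve
        add.assoc add.commute[of "Q * _"]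
      by blast
    show "c1*C3.r1X + c2*C3.r2X + c3*C3.r3X = 0 \<and> c1*C3.r1Z + c2*C3.r2Z + c3*C3.r3Z = 0 \<and>
        c1*C3.r1Y + c2*C3.r2Y + c3*C3.r3Y = 0 \<longleftrightarrow>
        (\<exists>n. c1 = - (var_z ^ 3) * n \<and> c2 = - var_y * n \<and> c3 = var_x * n)" for c1 c2 c3
      using C3.second_syzygies_iff[of c1 c2 c3] by blast
  qed (simp_all add: C3.partials_curve C3.homogeneous_h C3.homogeneous_r1 C3.homogeneous_r2
      C3.homogeneous_r3 C3.homogeneous_k C3.vars_nonzero homogeneous_numeral_mult)
  thus ?thesis
    by (simp add: syzygy_curve_def reduced_curve_def curves_eq C3.homogeneous_curve C3.squarefree_curve)
qed

theorem proposition4p10: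
  shows "nearly_free curve_C1 \<and> has_exponents curve_C1 [5, 7, 7] \<and>
         nearly_free curve_C2 \<and> has_exponents curve_C2 [5, 7, 7] \<and>
         nearly_free curve_C3 \<and> has_exponents curve_C3 [5, 7, 7]"
proof -
  have "nearly_free f \<and> has_exponents f [5, 7, 7]"
    if "syzygy_curve 3 12 f [5, 7, 7] [19]" for f
  proof
    \<comment> \<open>The numerical conditions are 5 + 7 = 12 and 19 = 12 + 7.\<close>
    show "nearly_free f" unfolding nearly_free_def
      by (rule exI[of _ 12], rule exI[of _ 5], rule exI[of _ 7], rule exI[of _ 7], rule exI[of _ 19])
        (simp add: that)
    show "has_exponents f [5, 7, 7]" unfolding has_exponents_def using that by blast
  qed
  thus ?thesis using syzygy_curve_C1 syzygy_curve_C2 syzygy_curve_C3 by blast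
qed

end
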